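(* For every $n\ge 2$ and every $\pi\in\mathfrak{S}_n$, $$h(\pi)=\tfrac12 E(\pi),$$ where $E(\pi)=\sum_{i=1}^n(\pi(i)-i)^2$ is the entropy of $\pi$ and $h(\pi)=\sum_{i=1}^{n-1}\sum_{j=1}^{n-1}\mathbf{WT}(\pi)_{i,j}$ is the Waldspurger height of $\pi$.
   Context: Let $(\pi_{a,b})$ be the $n\times n$ permutation matrix of $\pi$, with $\pi_{a,b}=1$ if $a=\pi(b)$ and $0$ otherwise. The Waldspurger matrix $\mathbf{WT}(\pi)$ is the $(n-1)\times(n-1)$ matrix with $$\mathbf{WT}(\pi)_{i,j}=\begin{cases}\sum_{a\le i,\ b>j}\pi_{a,b} & i\le j,\\ \sum_{a>i,\ b\le j}\pi_{a,b} & i\ge j\end{cases}$$ (the formulas agree for $i=j$). *)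

theory Defs
  imports Complex_Main "HOL-Combinatorics.Permutations"
begin

text \<open>
  Permutations of size \<open>n\<close> are functions \<open>p\<close> with \<open>p permutes {1..n}\<close>. Matrices are
  functions of a row and a column index, both counted from 1. Only the entries of
  \<open>perm_matrix p\<close> with indices in \<open>{1..n}\<close> and those of \<open>WT n p\<close> with indices in
  \<open>{1..n-1}\<close> are meaningful.
\<close>

definition perm_matrix :: "(nat \<Rightarrow> nat) \<Rightarrow> nat \<Rightarrow> nat \<Rightarrow> int" where
  "perm_matrix p a b = (if a = p b then 1 else 0)"

definition WT :: "nat \<Rightarrow> (nat \<Rightarrow> nat) \<Rightarrow> nat \<Rightarrow> nat \<Rightarrow> int" where
  "WT n p i j =
     (if i \<le> j then \<Sum>a\<in>{1..i}. \<Sum>b\<in>{j+1..n}. perm_matrix p a b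
      else \<Sum>a\<in>{i+1..n}. \<Sum>b\<in>{1..j}. perm_matrix p a b)"

definition entropy :: "nat \<Rightarrow> (nat \<Rightarrow> nat) \<Rightarrow> int" where
  "entropy n p = (\<Sum>i=1..n. (int (p i) - int i)\<^sup>2)"

definition waldspurger_height :: "nat \<Rightarrow> (nat \<Rightarrow> nat) \<Rightarrow> int" where
  "waldspurger_height n p = (\<Sum>i=1..n-1. \<Sum>j=1..n-1. WT n p i j)"

text \<open>On the diagonal both cases of \<open>WT\<close> give the same value.\<close>

lemma perm_matrix_col_sum:
  assumes "p permutes {1..n}" "b \<in> {1..n}"
  shows "(\<Sum>a\<in>{1..n}. perm_matrix p a b) = 1"
proof -
  have "p b \<in> {1..n}" using assms by (simp only: permutes_in_image)
  then show ?thesis by (simp add: perm_matrix_def)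
qed

lemma perm_matrix_row_sum:
  assumes "p permutes {1..n}" "a \<in> {1..n}"
  shows "(\<Sum>b\<in>{1..n}. perm_matrix p a b) = 1"
proof -
  have "inv p a \<in> {1..n}" using permutes_inv[OF assms(1)] assms(2) by (simp only: permutes_in_image)
  moreover have "perm_matrix p a b = (if b = inv p a then 1 else 0)" for b
    using permutes_inv_eq[OF assms(1), of a b] by (auto simp: perm_matrix_def)
  ultimately show ?thesis by simp
qed

lemma WT_diagonal:
  assumes "p permutes {1..n}" "i \<le> n"
  shows "(\<Sum>a\<in>{1..i}. \<Sum>b\<in>{i+1..n}. perm_matrix p a b) =
         (\<Sum>a\<in>{i+1..n}. \<Sum>b\<in>{1..i}. perm_matrix p a b)"
proof -
  let ?c = "\<Sum>a\<in>{1..i}. \<Sum>b\<in>{1..i}. perm_matrix p a b"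
  have split: "sum f {1..n} = sum f {1..i} + sum f {i+1..n}" for f :: "nat \<Rightarrow> int"
    using sum.ub_add_nat[of 1 i f "n - i"] assms(2) by simp
  have "int i = (\<Sum>a\<in>{1..i}. \<Sum>b\<in>{1..n}. perm_matrix p a b)"
    using assms by (simp add: perm_matrix_row_sum del: One_nat_def)
  then have rows: "int i = ?c + (\<Sum>a\<in>{1..i}. \<Sum>b\<in>{i+1..n}. perm_matrix p a b)"
    by (simp only: split sum.distrib)
  have "int i = (\<Sum>b\<in>{1..i}. \<Sum>a\<in>{1..n}. perm_matrix p a b)"
    using assms by (simp add: perm_matrix_col_sum del: One_nat_def)
  also have "\<dots> = (\<Sum>a\<in>{1..n}. \<Sum>b\<in>{1..i}. perm_matrix p a b)"
    by (rule sum.swap)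
  finally have "int i = ?c + (\<Sum>a\<in>{i+1..n}. \<Sum>b\<in>{1..i}. perm_matrix p a b)"
    by (simp only: split)
  with rows show ?thesis by simp
qed

end

theory Submission
  imports Defs
begin

text \<open>
  Every entry of the Waldspurger matrix counts ones of the permutation matrix, so the height may be
  computed by asking how often each one, at position \<open>(p b, b)\<close>, is counted
  (\<open>WT_eq_sum_over_columns\<close>). With \<open>d = b - p b\<close>, a one on or above the diagonal (\<open>d \<ge> 0\<close>)
  is counted by the \<open>d * (d + 1) / 2\<close> entries with \<open>p b \<le> i \<le> j < b\<close>. A one below the diagonal
  is counted by the entries with
  \<open>b \<le> j < i < p b\<close>; the diagonal entries \<open>i = j\<close> count only ones of the first kind, so there are only
  \<open>\<bar>d\<bar> * (\<bar>d\<bar> - 1) / 2\<close> of them. Because \<open>d\<close> is negative here, this is again \<open>d * (d + 1) / 2\<close>, and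
  no case distinction survives (\<open>twice_waldspurger_contribution\<close>). Hence twice the height is the
  sum of \<open>d\<^sup>2 + d\<close> over all \<open>b\<close>; the squares give the entropy, and the linear terms cancel because
  a permutation preserves the sum of \<open>1, \<dots>, n\<close> (\<open>sum_displacement_eq_0\<close>).
\<close>

definition counts_one_at :: "nat \<Rightarrow> nat \<Rightarrow> nat \<Rightarrow> nat \<Rightarrow> bool" where
  "counts_one_at i j a b = (if i \<le> j then a \<le> i \<and> j < b else i < a \<and> b \<le> j)"

text \<open>Each column \<open>b\<close> contains a single one, so summing it over a range of rows leaves an indicator.\<close>

lemma WT_eq_sum_over_columns:
  assumes "p permutes {1..n}"
  shows "WT n p i j = (\<Sum>b\<in>{1..n}. of_bool (counts_one_at i j (p b) b))"
proof -
  have range: "1 \<le> p b" "p b \<le> n" if "b \<in> {1..n}" for b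
    using permutes_in_image[OF assms, of b] that by auto
  show ?thesis
  proof (cases "i \<le> j")
    case True
    have "WT n p i j = (\<Sum>b\<in>{j+1..n}. \<Sum>a\<in>{1..i}. perm_matrix p a b)"
      using True by (simp only: WT_def if_True) (rule sum.swap)
    also have "\<dots> = (\<Sum>b\<in>{j+1..n}. of_bool (counts_one_at i j (p b) b))"
      using True range by (intro sum.cong) (auto simp: perm_matrix_def counts_one_at_def)
    also have "\<dots> = (\<Sum>b\<in>{1..n}. of_bool (counts_one_at i j (p b) b))"
      using True by (intro sum.mono_neutral_left) (auto simp: counts_one_at_def)
    finally show ?thesis .
  next
    case False
    have "WT n p i j = (\<Sum>b\<in>{1..j}. \<Sum>a\<in>{i+1..n}. perm_matrix p a b)"
      using False by (simp only: WT_def if_False) (rule sum.swap)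
    also have "\<dots> = (\<Sum>b\<in>{1..j}. \<Sum>a\<in>{i+1..n}. if a = p b then 1 else 0)"
      by (simp add: perm_matrix_def)
    also have "\<dots> = (\<Sum>b\<in>{1..j} \<inter> {1..n}. of_bool (counts_one_at i j (p b) b))"
    proof (rule sum.mono_neutral_cong_right)
      \<comment> \<open>If \<open>j > n\<close>, then \<open>i > n\<close> as well and the range of rows is empty.\<close>
      show "\<forall>b\<in>{1..j} - {1..j} \<inter> {1..n}. (\<Sum>a\<in>{i+1..n}. if a = p b then 1 else (0::int)) = 0"
        using False by auto
    qed (use False range in \<open>auto simp: counts_one_at_def\<close>)
    also have "\<dots> = (\<Sum>b\<in>{1..n}. of_bool (counts_one_at i j (p b) b))"
      using False by (intro sum.mono_neutral_left) (auto simp: counts_one_at_def)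
    finally show ?thesis .
  qed
qed

lemma twice_sum_distance_to_upper:
  "x \<le> y \<Longrightarrow> 2 * (\<Sum>i\<in>{x..<y}. int y - int i) = (int y - int x) * (int y - int x + 1)"
  by (induction x rule: inc_induct) (auto simp: sum.atLeast_Suc_lessThan algebra_simps)

lemma twice_sum_distance_to_lower:
  "y \<le> x \<Longrightarrow> 2 * (\<Sum>i\<in>{y..<x}. int i - int y) = (int y - int x) * (int y - int x + 1)"
  by (induction x rule: dec_induct) (auto simp: algebra_simps)

text \<open>
  Row \<open>i\<close> contains \<open>b - i\<close> counting entries if \<open>a \<le> i < b\<close>, and \<open>i - b\<close> of them if \<open>b \<le> i < a\<close>.
  Summed over \<open>i\<close>, the smallest term is \<open>1\<close> in the first case and \<open>0\<close> in the second; this shift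
  is what makes both of them equal to the same polynomial in \<open>b - a\<close>.
\<close>

lemma twice_waldspurger_contribution:
  assumes "a \<in> {1..n}" "b \<in> {1..n}"
  shows "2 * (\<Sum>i=1..n-1. \<Sum>j=1..n-1. of_bool (counts_one_at i j a b)) =
         (int b - int a)\<^sup>2 + (int b - int a)"
proof -
  let ?row = "\<lambda>i. if a \<le> i \<and> i < b then int b - int i else if b \<le> i \<and> i < a then int i - int b else 0"
  have row: "(\<Sum>j=1..n-1. of_bool (counts_one_at i j a b)) = ?row i"
    if "i \<in> {1..n-1}" for i
  proof -
    have "{j \<in> {1..n-1}. counts_one_at i j a b} = (if a \<le> i then {i..<b} else {b..<i})"
      using assms that by (auto simp: counts_one_at_def split: if_splits)
    then have "(\<Sum>j=1..n-1. of_bool (counts_one_at i j a b)) =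
        int (card (if a \<le> i then {i..<b} else {b..<i}))"
      by (simp add: of_bool_def sum.If_cases Int_def)
    then show ?thesis by auto
  qed
  have rows: "(\<Sum>i=1..n-1. \<Sum>j=1..n-1. of_bool (counts_one_at i j a b)) = sum ?row {1..n-1}"
    by (intro sum.cong refl row)
  have "2 * sum ?row {1..n-1} = (int b - int a) * (int b - int a + 1)"
  proof (cases "a \<le> b")
    case True
    have "sum ?row {1..n-1} = (\<Sum>i\<in>{a..<b}. int b - int i)"
      using assms True by (intro sum.mono_neutral_cong_right) auto
    then show ?thesis by (simp only: twice_sum_distance_to_upper[OF True])
  next
    case False
    have "sum ?row {1..n-1} = (\<Sum>i\<in>{b..<a}. int i - int b)"
      using assms False by (intro sum.mono_neutral_cong_right) auto
    then show ?thesis using False by (simp only: twice_sum_distance_to_lower)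
  qed
  then show ?thesis unfolding rows by (simp add: power2_eq_square algebra_simps)
qed

lemma sum_displacement_eq_0:
  assumes "p permutes {1..n::nat}"
  shows "(\<Sum>b\<in>{1..n}. int b - int (p b)) = 0"
  using sum.permute[OF assms, of int] by (simp add: sum_subtractf comp_def)

lemma twice_waldspurger_height:
  assumes "p permutes {1..n}"
  shows "2 * waldspurger_height n p = entropy n p"
proof -
  have "2 * waldspurger_height n p =
      2 * (\<Sum>i=1..n-1. \<Sum>b=1..n. \<Sum>j=1..n-1. of_bool (counts_one_at i j (p b) b))"
    unfolding waldspurger_height_def WT_eq_sum_over_columns[OF assms]
    by (subst sum.swap) (rule refl)
  also have "\<dots> = (\<Sum>b=1..n. 2 * (\<Sum>i=1..n-1. \<Sum>j=1..n-1. of_bool (counts_one_at i j (p b) b)))"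
    by (subst sum.swap) (rule sum_distrib_left)
  also have "\<dots> = (\<Sum>b=1..n. (int b - int (p b))\<^sup>2 + (int b - int (p b)))"
    by (intro sum.cong refl twice_waldspurger_contribution)
      (simp_all only: permutes_in_image[OF assms])
  also have "\<dots> = (\<Sum>b=1..n. (int b - int (p b))\<^sup>2)"
    by (simp only: sum.distrib sum_displacement_eq_0[OF assms] add_0_right)
  also have "\<dots> = entropy n p"
    by (simp add: entropy_def power2_commute)
  finally show ?thesis .
qed

theorem theorem8:
  fixes n :: nat and p :: "nat \<Rightarrow> nat"
  assumes "n \<ge> 2" and "p permutes {1..n}"
  shows "real_of_int (waldspurger_height n p) = 1 / 2 * real_of_int (entropy n p)"
  unfolding twice_waldspurger_height[OF assms(2), symmetric] by simp

end
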